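(* Let $\mathcal{A}=(A;E_0,E_1)$ be a $2$-grid which is not twisted. Then either the $2$-cube $l\times\omega_1$ can be embedded in $\mathcal{A}$ for every $l\in\omega$, or the $2$-cube $\omega_1\times l$ can be embedded in $\mathcal{A}$ for every $l\in\omega$.
   Context: A $2$-grid is a structure $\mathcal{A}=(A;E_0,E_1)$ where $E_0,E_1$ are equivalence relations on $A$ and $[a]_0\cap[a]_1$ is finite for every $a\in A$ ($[a]_i$ is the $E_i$-class of $a$). For sets $A_0,A_1$, the $2$-cube $A_0\times A_1$ is the $2$-grid on $A_0\times A_1$ where $(x_0,x_1)\,E_0\,(y_0,y_1)$ iff $x_1=y_1$, and $(x_0,x_1)\,E_1\,(y_0,y_1)$ iff $x_0=y_0$; here $l=\{0,\dots,l-1\}$. An embedding of a $2$-grid $(B;F_0,F_1)$ into $\mathcal{A}$ is an injective map $f:B\to A$ with $x\,F_i\,y$ iff $f(x)\,E_i\,f(y)$ for all $x,y\in B$, $i\in 2$. For an equivalence relation $E$ on $A$, $B\subseteq A$ is $E$-small if every $E$-class meets $B$ in a finite set. An "elementary submodel of the universe" is an $M$ with $(M,\in)\prec(H(\theta),\in)$ for a fixed sufficiently large regular cardinal $\theta$. A test set for a $2$-grid $\mathcal{A}$ is a set $\mathcal{M}=\{M\}$ consisting of a single elementary submodel $M$ with $\mathcal{A}\in M$. $\mathcal{A}$ is twisted if for every such $M$ and every $k\in 2$, the set $\{x\in A\setminus M : [x]_{1-k}\in M\}$ is $E_k$-small. *)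

theory Defs
  imports Main
begin

unbundle cardinal_syntax

section \<open>A universe of sets\<close>

text \<open>
  Well-founded trees branching over \<^typ>\<open>'k\<close>, identified when they are extensionally equal,
  form, for infinite \<^typ>\<open>'k\<close> and up to isomorphism, the sets whose hereditary cardinality is
  at most \<open>|UNIV :: 'k set|\<close>. Every cardinal \<open>\<theta> :: 'k rel\<close> satisfies \<open>\<theta> \<le>o |UNIV :: 'k set|\<close>, so
  \<open>H(\<theta>)\<close> is a part of this universe; as \<^typ>\<open>'k\<close> is arbitrary, all \<open>H(\<theta>)\<close> occur.
\<close>

datatype 'k tree = Empty | Node "'k \<Rightarrow> 'k tree"

primrec children :: "'k tree \<Rightarrow> 'k tree set" where
  "children Empty = {}"
| "children (Node f) = range f"

primrec ext_eq :: "'k tree \<Rightarrow> 'k tree \<Rightarrow> bool" where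
  "ext_eq Empty = (\<lambda>t. children t = {})"
| "ext_eq (Node f) = (\<lambda>t. (\<forall>i. \<exists>s\<in>children t. ext_eq (f i) s) \<and>
                           (\<forall>s\<in>children t. \<exists>i. ext_eq (f i) s))"

lemma ext_eq_iff:
  "ext_eq s t \<longleftrightarrow> (\<forall>a\<in>children s. \<exists>b\<in>children t. ext_eq a b) \<and>
                  (\<forall>b\<in>children t. \<exists>a\<in>children s. ext_eq a b)"
  by (cases s) auto

lemma tree_induct_children:
  assumes "\<And>t. (\<And>s. s \<in> children t \<Longrightarrow> P s) \<Longrightarrow> P t"
  shows "P t"
proof (induction t)
  case Empty
  show ?case by (rule assms) simp
next
  case (Node f)
  show ?case by (rule assms) (auto intro: Node)
qed

lemma ext_eq_refl: "ext_eq t t"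
  by (induction t rule: tree_induct_children) (subst ext_eq_iff, blast)

lemma ext_eq_sym: "ext_eq s t \<Longrightarrow> ext_eq t s"
proof (induction s arbitrary: t rule: tree_induct_children)
  case (1 s)
  then show ?case
    by (subst ext_eq_iff) (meson ext_eq_iff)
qed

lemma ext_eq_trans: "ext_eq s t \<Longrightarrow> ext_eq t u \<Longrightarrow> ext_eq s u"
proof (induction s arbitrary: t u rule: tree_induct_children)
  case (1 s)
  have "\<exists>c\<in>children u. ext_eq a c" if "a \<in> children s" for a
    using 1 that by (meson ext_eq_iff)
  moreover have "\<exists>a\<in>children s. ext_eq a c" if "c \<in> children u" for c
    using 1 that by (meson ext_eq_iff)
  ultimately show ?case
    by (subst ext_eq_iff) blast
qed

quotient_type 'k V = "'k tree" / ext_eq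
  by (intro equivpI reflpI sympI transpI) (blast intro: ext_eq_refl ext_eq_sym ext_eq_trans)+

definition elts :: "'k V \<Rightarrow> 'k V set" where
  "elts x = abs_V ` children (rep_V x)"

definition mem_rel :: "'k V rel" where
  "mem_rel = {(x, y). x \<in> elts y}"

definition small :: "'k V set \<Rightarrow> bool" where
  "small X \<longleftrightarrow> |X| \<le>o |UNIV :: 'k set|"

text \<open>The set with the given elements; unspecified if there is none, i.e. if \<open>X\<close> is not small.\<close>

definition vset :: "'k V set \<Rightarrow> 'k V" where
  "vset X = (THE x. elts x = X)"

text \<open>The next lemmas confirm that this is an extensional, well-founded universe in which
  exactly the small collections are sets.\<close>

lemma abs_V_eq_iff: "abs_V s = abs_V t \<longleftrightarrow> ext_eq s t"
  by (rule V.abs_eq_iff)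

lemma ext_eq_rep_abs: "ext_eq (rep_V (abs_V t)) t"
  by (metis Quotient3_V Quotient3_abs_rep abs_V_eq_iff)

lemma elts_abs: "elts (abs_V t) = abs_V ` children t"
proof -
  have *: "\<forall>a\<in>children (rep_V (abs_V t)). \<exists>b\<in>children t. ext_eq a b"
          "\<forall>b\<in>children t. \<exists>a\<in>children (rep_V (abs_V t)). ext_eq a b"
    using ext_eq_rep_abs[of t] ext_eq_iff by blast+
  show ?thesis
    unfolding elts_def
  proof (intro equalityI subsetI)
    fix y assume "y \<in> abs_V ` children (rep_V (abs_V t))"
    then obtain a b where "y = abs_V a" "b \<in> children t" "ext_eq a b"
      using *(1) by blast
    then show "y \<in> abs_V ` children t"
      by (auto simp flip: abs_V_eq_iff)
  next
    fix y assume "y \<in> abs_V ` children t"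
    then obtain a b where "y = abs_V b" "a \<in> children (rep_V (abs_V t))" "abs_V a = abs_V b"
      using *(2) unfolding abs_V_eq_iff by blast
    then show "y \<in> abs_V ` children (rep_V (abs_V t))"
      by (metis imageI)
  qed
qed

lemma abs_rep_V: "abs_V (rep_V x) = x"
  by (rule Quotient3_abs_rep[OF Quotient3_V])

lemma ex_abs_V: "\<exists>t. x = abs_V t"
  by (rule exI[of _ "rep_V x"]) (simp add: abs_rep_V)

lemma elts_inject:
  assumes "elts x = elts y" shows "x = y"
proof -
  obtain s t where st: "x = abs_V s" "y = abs_V t"
    using ex_abs_V by blast
  then have *: "abs_V ` children s = abs_V ` children t"
    using assms by (simp add: elts_abs)
  have "\<exists>b\<in>children t. ext_eq a b" if "a \<in> children s" for a
    using imageI[OF that, of abs_V] unfolding * by (auto simp: abs_V_eq_iff)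
  moreover have "\<exists>a\<in>children s. ext_eq a b" if "b \<in> children t" for b
    using imageI[OF that, of abs_V] unfolding *[symmetric] image_iff abs_V_eq_iff
    by (blast intro: ext_eq_sym)
  ultimately have "ext_eq s t"
    by (subst ext_eq_iff) blast
  then show ?thesis by (simp add: st abs_V_eq_iff)
qed

lemma wf_mem_rel: "wf mem_rel"
proof (rule wfUNIVI)
  fix P :: "'a V \<Rightarrow> bool" and x
  assume IH: "\<forall>x. (\<forall>y. (y, x) \<in> mem_rel \<longrightarrow> P y) \<longrightarrow> P x"
  have "P (abs_V t)" for t
  proof (induction t rule: tree_induct_children)
    case (1 t)
    have "P y" if "(y, abs_V t) \<in> mem_rel" for y
      using that 1 by (auto simp: mem_rel_def elts_abs)
    then show ?case using IH by blast
  qed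
  then show "P x" using ex_abs_V[of x] by auto
qed

lemma small_elts: "small (elts x)"
proof -
  obtain t where x: "x = abs_V t" using ex_abs_V by blast
  show ?thesis
  proof (cases t)
    case Empty
    then show ?thesis
      unfolding small_def by (simp add: x elts_abs card_of_empty)
  next
    case (Node f)
    then show ?thesis
      unfolding small_def by (simp add: x elts_abs image_image card_of_image)
  qed
qed

lemma small_imp_ex_elts:
  fixes X :: "'k V set"
  assumes "small X" shows "\<exists>x. elts x = X"
proof (cases "X = {}")
  case True
  then have "elts (abs_V Empty) = X" by (simp add: elts_abs)
  then show ?thesis by blast
next
  case False
  then obtain g :: "'k \<Rightarrow> 'k V" where g: "range g = X"
    using assms card_of_ordLeq2[of X "UNIV :: 'k set"] unfolding small_def by blast
  have "elts (abs_V (Node (rep_V \<circ> g))) = X"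
    using g by (simp add: elts_abs image_image abs_rep_V)
  then show ?thesis by blast
qed

lemma vset_elts: "vset (elts x) = x"
  unfolding vset_def by (rule the_equality) (auto intro: elts_inject)

lemma elts_vset: "small X \<Longrightarrow> elts (vset X) = X"
  using small_imp_ex_elts vset_elts by metis


section \<open>\<open>H(\<theta>)\<close> and its elementary submodels\<close>

definition trcl :: "'k V \<Rightarrow> 'k V set" where
  "trcl x = {y. (y, x) \<in> mem_rel\<^sup>+}"

definition Hset :: "'k rel \<Rightarrow> 'k V set" where
  "Hset \<theta> = {x. |trcl x| <o \<theta>}"

text \<open>First-order formulas in the language of set theory, with variables \<open>v\<^sub>0, v\<^sub>1, \<dots>\<close>.\<close>

datatype form = Mem nat nat | Eq nat nat | Neg form | Conj form form | Ex nat form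

primrec sat :: "'k V set \<Rightarrow> (nat \<Rightarrow> 'k V) \<Rightarrow> form \<Rightarrow> bool" where
  "sat D v (Mem i j) \<longleftrightarrow> v i \<in> elts (v j)"
| "sat D v (Eq i j) \<longleftrightarrow> v i = v j"
| "sat D v (Neg \<phi>) \<longleftrightarrow> \<not> sat D v \<phi>"
| "sat D v (Conj \<phi> \<psi>) \<longleftrightarrow> sat D v \<phi> \<and> sat D v \<psi>"
| "sat D v (Ex i \<phi>) \<longleftrightarrow> (\<exists>a\<in>D. sat D (v(i := a)) \<phi>)"

definition elem_submodel :: "'k rel \<Rightarrow> 'k V set \<Rightarrow> bool" where
  "elem_submodel \<theta> M \<longleftrightarrow> M \<noteq> {} \<and> M \<subseteq> Hset \<theta> \<and>
     (\<forall>\<phi> v. range v \<subseteq> M \<longrightarrow> (sat M v \<phi> \<longleftrightarrow> sat (Hset \<theta>) v \<phi>))"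


section \<open>\<open>2\<close>-grids\<close>

text \<open>A \<open>2\<close>-grid \<open>(A; E\<^sub>0, E\<^sub>1)\<close> is given by \<open>A\<close> and \<open>E\<close>, where only \<open>E 0\<close> and \<open>E 1\<close> matter.\<close>

definition two_grid :: "'a set \<Rightarrow> (nat \<Rightarrow> 'a rel) \<Rightarrow> bool" where
  "two_grid A E \<longleftrightarrow> (\<forall>i<2. equiv A (E i)) \<and> (\<forall>a\<in>A. finite (E 0 `` {a} \<inter> E 1 `` {a}))"

definition cube :: "'a set \<Rightarrow> 'b set \<Rightarrow> nat \<Rightarrow> ('a \<times> 'b) rel" where
  "cube A\<^sub>0 A\<^sub>1 i = {(x, y). x \<in> A\<^sub>0 \<times> A\<^sub>1 \<and> y \<in> A\<^sub>0 \<times> A\<^sub>1 \<and>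
                         (if i = 0 then snd x = snd y else fst x = fst y)}"

definition grid_embedding ::
  "('b \<Rightarrow> 'a) \<Rightarrow> 'b set \<Rightarrow> (nat \<Rightarrow> 'b rel) \<Rightarrow> 'a set \<Rightarrow> (nat \<Rightarrow> 'a rel) \<Rightarrow> bool" where
  "grid_embedding f B F A E \<longleftrightarrow> f ` B \<subseteq> A \<and> inj_on f B \<and>
     (\<forall>i<2. \<forall>x\<in>B. \<forall>y\<in>B. (x, y) \<in> F i \<longleftrightarrow> (f x, f y) \<in> E i)"

definition cube_embeds :: "'b set \<Rightarrow> 'c set \<Rightarrow> 'a set \<Rightarrow> (nat \<Rightarrow> 'a rel) \<Rightarrow> bool" where
  "cube_embeds A\<^sub>0 A\<^sub>1 A E \<longleftrightarrow> (\<exists>f. grid_embedding f (A\<^sub>0 \<times> A\<^sub>1) (cube A\<^sub>0 A\<^sub>1) A E)"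

text \<open>A concrete set of cardinality \<open>\<aleph>\<^sub>1\<close>; the order of \<open>\<omega>\<^sub>1\<close> plays no role in a cube.\<close>

definition omega1 :: "nat set set" where
  "omega1 = Field (cardSuc natLeq)"

definition rel_small :: "'a set \<Rightarrow> 'a rel \<Rightarrow> 'a set \<Rightarrow> bool" where
  "rel_small A R B \<longleftrightarrow> B \<subseteq> A \<and> (\<forall>C\<in>A // R. finite (C \<inter> B))"


section \<open>Twisted \<open>2\<close>-grids\<close>

text \<open>Kuratowski pairs, and the \<open>2\<close>-grid \<open>(A; E\<^sub>0, E\<^sub>1)\<close> as a single set.\<close>

definition vpair :: "'k V \<Rightarrow> 'k V \<Rightarrow> 'k V" where
  "vpair x y = vset {vset {x}, vset {x, y}}"

definition vrel :: "'k V rel \<Rightarrow> 'k V" where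
  "vrel R = vset {vpair x y | x y. (x, y) \<in> R}"

definition vgrid :: "'k V set \<Rightarrow> (nat \<Rightarrow> 'k V rel) \<Rightarrow> 'k V" where
  "vgrid A E = vpair (vset A) (vpair (vrel (E 0)) (vrel (E 1)))"

definition twisted :: "'k rel \<Rightarrow> 'k V set \<Rightarrow> (nat \<Rightarrow> 'k V rel) \<Rightarrow> bool" where
  "twisted \<theta> A E \<longleftrightarrow> (\<forall>M. elem_submodel \<theta> M \<and> vgrid A E \<in> M \<longrightarrow>
     (\<forall>k<2. rel_small A (E k) {x \<in> A - M. vset (E (1 - k) `` {x}) \<in> M}))"

end

theory Submission
  imports Defs "HOL-Library.Countable_Set_Type"
begin

text \<open>
  If \<open>\<A>\<close> is not twisted, some \<open>E\<^sub>k\<close>-class \<open>C\<close> contains points \<open>x\<^sub>0, x\<^sub>1, \<dots>\<close> outside \<open>M\<close> whose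
  \<open>E\<^sub>1\<^sub>-\<^sub>k\<close>-classes \<open>B\<^sub>0, B\<^sub>1, \<dots>\<close> are pairwise distinct members of \<open>M\<close>. The set \<open>D\<close> of all \<open>z \<in> B\<^sub>0\<close>
  whose \<open>E\<^sub>k\<close>-class meets all of \<open>B\<^sub>0, \<dots>, B\<^sub>l\<^sub>-\<^sub>1\<close> belongs to \<open>M\<close> and contains \<open>x\<^sub>0 \<notin> M\<close>. Countable
  members of \<open>M\<close> are subsets of \<open>M\<close>, so \<open>D\<close> is uncountable, and as every \<open>E\<^sub>k\<close>-class
  meets \<open>B\<^sub>0\<close> in a finite set, uncountably many \<open>E\<^sub>k\<close>-classes meet all of \<open>B\<^sub>0, \<dots>, B\<^sub>l\<^sub>-\<^sub>1\<close>.
\<close>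

text \<open>An injection into the naturals orders \<open>D\<close> so that every element except the
  least has an immediate predecessor; hence the least element \<open>d\<close> and the partial map
  \<open>S\<close> to the next element reach all of \<open>D\<close>. This expresses countability by
  a point and a set of pairs.\<close>

lemma countable_obtain_successor:
  assumes "countable D" and "D \<noteq> {}"
  obtains S d where "S \<subseteq> D \<times> D" and "single_valued S" and "d \<in> D"
    and "\<forall>X. d \<in> X \<and> S `` X \<subseteq> X \<longrightarrow> D \<subseteq> X"
proof -
  let ?g = "to_nat_on D"
  have inj: "x = y" if "x \<in> D" "y \<in> D" "?g x = ?g y" for x y
    using inj_on_to_nat_on[OF assms(1)] that by (blast dest: inj_onD)
  \<comment> \<open>Only injectivity of \<open>?g\<close> is used, so \<open>S\<close> steps to the
    next value that occurs rather than to \<open>?g x + 1\<close>.\<close>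
  define S where "S = {(x, y) \<in> D \<times> D. ?g x < ?g y \<and> (\<forall>z\<in>D. \<not> (?g x < ?g z \<and> ?g z < ?g y))}"
  obtain d where d: "d \<in> D" "\<And>z. z \<in> D \<Longrightarrow> ?g d \<le> ?g z"
    using ex_has_least_nat[of "\<lambda>x. x \<in> D" _ ?g] assms(2) by blast
  show ?thesis
  proof
    show "S \<subseteq> D \<times> D" by (auto simp: S_def)
    show "single_valued S"
    proof (rule single_valuedI)
      fix x y z assume "(x, y) \<in> S" "(x, z) \<in> S"
      then have "y \<in> D" "z \<in> D" "\<not> ?g y < ?g z" "\<not> ?g z < ?g y"
        by (auto simp: S_def)
      then show "y = z" using inj by (meson linorder_neqE_nat)
    qed
    show "d \<in> D" by (fact d)
    show "\<forall>X. d \<in> X \<and> S `` X \<subseteq> X \<longrightarrow> D \<subseteq> X"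
    proof (intro allI impI; elim conjE)
      fix X assume X: "d \<in> X" "S `` X \<subseteq> X"
      have "y \<in> X" if "y \<in> D" for y
        using that
      proof (induction "?g y" arbitrary: y rule: less_induct)
        case less
        show ?case
        proof (cases "y = d")
          case False
          \<comment> \<open>The predecessor of \<open>y\<close> is the element of \<open>?P\<close>
            with the largest number; it exists because \<open>?g y\<close> bounds these
            numbers.\<close>
          let ?P = "{z \<in> D. ?g z < ?g y}"
          have "?g d < ?g y"
            using False d(1) d(2)[OF less.prems] less.prems inj[of d y] by (cases "?g d = ?g y") auto
          then have "d \<in> ?P" using d(1) by simp
          then have "\<exists>x. x \<in> ?P \<and> (\<forall>z. z \<in> ?P \<longrightarrow> ?g z \<le> ?g x)"
            by (rule ex_has_greatest_nat[where b = "?g y"]) blast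
          then obtain x where x: "x \<in> D" "?g x < ?g y"
            and max: "\<And>z. z \<in> D \<Longrightarrow> ?g z < ?g y \<Longrightarrow> ?g z \<le> ?g x"
            by blast
          have "\<not> (?g x < ?g z \<and> ?g z < ?g y)" if "z \<in> D" for z
            using max[OF that] by linarith
          then have "(x, y) \<in> S"
            using x less.prems unfolding S_def by blast
          moreover have "x \<in> X" using x less.hyps by blast
          ultimately show ?thesis using X(2) by blast
        qed (simp add: X)
      qed
      then show "D \<subseteq> X" by blast
    qed
  qed
qed


section \<open>Closure properties of \<open>H(\<theta>)\<close>\<close>

lemma trcl_mono: "y \<in> elts x \<Longrightarrow> trcl y \<subseteq> trcl x"
  by (auto simp: trcl_def mem_rel_def intro: trancl_into_trancl)

lemma elts_subset_trcl: "elts x \<subseteq> trcl x"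
  by (auto simp: trcl_def mem_rel_def)

lemma trcl_eq: "trcl x = elts x \<union> (\<Union>y\<in>elts x. trcl y)"
proof
  show "trcl x \<subseteq> elts x \<union> (\<Union>y\<in>elts x. trcl y)"
    by (auto simp: trcl_def mem_rel_def elim: tranclE)
  show "elts x \<union> (\<Union>y\<in>elts x. trcl y) \<subseteq> trcl x"
    by (intro Un_least UN_least elts_subset_trcl trcl_mono)
qed

lemma Hset_trans: "y \<in> elts x \<Longrightarrow> x \<in> Hset \<theta> \<Longrightarrow> y \<in> Hset \<theta>"
  using trcl_mono[of y x] unfolding Hset_def
  by (auto intro: ordLeq_ordLess_trans[OF card_of_mono1])

text \<open>Regularity puts every set of fewer than \<theta> members of H(\<theta>) into
  H(\<theta>); uncountability of \<theta> covers the countable sets.\<close>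

locale regular_uncountable =
  fixes \<theta> :: "'k rel"
  assumes card: "Card_order \<theta>" and regular: "regularCard \<theta>" and uncountable: "natLeq <o \<theta>"
begin

lemma Cinfinite_theta: "Cinfinite \<theta>"
  using card uncountable natLeq_cinfinite cinfinite_mono ordLess_imp_ordLeq by blast

lemma theta_le_UNIV: "\<theta> \<le>o |UNIV :: 'k set|"
  using card_of_Field_ordIso[OF card] card_of_mono1[of "Field \<theta>" UNIV]
  by (meson ordIso_ordLeq_trans ordIso_symmetric subset_UNIV)

lemma countable_less_theta: "countable X \<Longrightarrow> |X| <o \<theta>"
  using uncountable by (simp add: countable_card_le_natLeq ordLeq_ordLess_trans)

lemma small_if_less: "|X :: 'k V set| <o \<theta> \<Longrightarrow> small X"
  unfolding small_def using theta_le_UNIV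
  by (meson ordLess_imp_ordLeq ordLess_ordLeq_trans)

lemma small_countable: "countable (X :: 'k V set) \<Longrightarrow> small X"
  by (intro small_if_less countable_less_theta)

lemma elts_vset_finite [simp]: "finite X \<Longrightarrow> elts (vset (X :: 'k V set)) = X"
  by (intro elts_vset small_countable countable_finite)

lemma vset_eq_iff:
  assumes "finite (X :: 'k V set)" and "finite Y"
  shows "vset X = vset Y \<longleftrightarrow> X = Y"
  using assms by (metis elts_vset_finite)

lemma vpair_eq_iff [simp]: "vpair x (y :: 'k V) = vpair x' y' \<longleftrightarrow> x = x' \<and> y = y'"
  by (auto simp: vpair_def vset_eq_iff doubleton_eq_iff)

text \<open>Since \<open>'k\<close> is infinite, \<open>A\<close> \<times> \<open>A\<close> is small
  along with \<open>A\<close>. So \<open>vrel R\<close> is the intended set and not the unspecified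
  value of \<open>vset\<close>.\<close>

lemma elts_vrel:
  assumes "R \<subseteq> A \<times> A" and "small (A :: 'k V set)"
  shows "elts (vrel R) = {vpair x y | x y. (x, y) \<in> R}"
proof -
  have inf: "infinite (UNIV :: 'k set)"
    using Cinfinite_theta finite_subset[of "Field \<theta>" UNIV] by (auto simp: cinfinite_def)
  have "{vpair x y | x y. (x, y) \<in> R} = (\<lambda>(x, y). vpair x y) ` R"
    by auto
  then have "|{vpair x y | x y. (x, y) \<in> R}| \<le>o |R|"
    by (simp add: card_of_image)
  also have "|R| \<le>o |A \<times> A|"
    using assms(1) by (rule card_of_mono1)
  also have "|A \<times> A| \<le>o |UNIV :: 'k set|"
    using assms(2) inf card_of_Times_ordLeq_infinite_Field[of "|UNIV :: 'k set|" A A]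
    unfolding small_def by (simp add: Field_card_of card_of_Card_order[unfolded Field_card_of])
  finally show ?thesis
    unfolding vrel_def by (intro elts_vset) (simp add: small_def)
qed

text \<open>The transitive closure is a union of fewer than \<theta> sets, each of size below
  \<theta>, together with \<open>X\<close>.\<close>

lemma vset_in_Hset:
  assumes "X \<subseteq> Hset \<theta>" and "|X| <o \<theta>"
  shows "vset X \<in> Hset \<theta>"
proof -
  have "|\<Union>x\<in>X. trcl x| <o \<theta>"
    using assms by (intro card_of_UNION_ordLess_infinite_Field_regularCard[OF regular Cinfinite_theta])
      (auto simp: Hset_def)
  then have "|X \<union> (\<Union>x\<in>X. trcl x)| <o \<theta>"
    using assms(2) Cinfinite_theta
    by (intro card_of_Un_ordLess_infinite_Field) (auto simp: cinfinite_def)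
  moreover have "trcl (vset X) = X \<union> (\<Union>x\<in>X. trcl x)"
    using assms(2) by (subst trcl_eq) (simp add: elts_vset small_if_less)
  ultimately show ?thesis by (simp add: Hset_def)
qed

lemma vset_insert_in_Hset: "x \<in> Hset \<theta> \<Longrightarrow> y \<in> Hset \<theta> \<Longrightarrow> vset {x, y} \<in> Hset \<theta>"
  by (intro vset_in_Hset countable_less_theta) auto

lemma vpair_in_Hset: "x \<in> Hset \<theta> \<Longrightarrow> y \<in> Hset \<theta> \<Longrightarrow> vpair x y \<in> Hset \<theta>"
  using vset_insert_in_Hset[of x x] vset_insert_in_Hset[of x y]
  by (auto simp: vpair_def intro: vset_insert_in_Hset)

lemma vpair_in_HsetD: "vpair x y \<in> Hset \<theta> \<Longrightarrow> x \<in> Hset \<theta> \<and> y \<in> Hset \<theta>"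
  using Hset_trans[of "vset {x, y}" "vpair x y"] Hset_trans[of _ "vset {x, y}"]
  by (auto simp: vpair_def)

text \<open>Through this closure under subsets, a quantifier over H(\<theta>) reaches all subsets of
  a member of H(\<theta>).\<close>

lemma vset_subset_in_Hset:
  assumes "x \<in> Hset \<theta>" and "X \<subseteq> elts x"
  shows "vset X \<in> Hset \<theta>" and "elts (vset X) = X"
proof -
  have less: "|X| <o \<theta>"
    using assms elts_subset_trcl[of x] unfolding Hset_def
    by (auto intro: ordLeq_ordLess_trans[OF card_of_mono1])
  show "vset X \<in> Hset \<theta>"
    using assms less by (intro vset_in_Hset) (auto intro: Hset_trans)
  show "elts (vset X) = X"
    using less by (intro elts_vset small_if_less)
qed

end


section \<open>Definability\<close>

definition Imp_form :: "form \<Rightarrow> form \<Rightarrow> form" where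
  "Imp_form \<phi> \<psi> = Neg (Conj \<phi> (Neg \<psi>))"

definition Iff_form :: "form \<Rightarrow> form \<Rightarrow> form" where
  "Iff_form \<phi> \<psi> = Conj (Imp_form \<phi> \<psi>) (Imp_form \<psi> \<phi>)"

definition All_form :: "nat \<Rightarrow> form \<Rightarrow> form" where
  "All_form i \<phi> = Neg (Ex i (Neg \<phi>))"

lemma sat_simps [simp]:
  "sat D v (Imp_form \<phi> \<psi>) \<longleftrightarrow> (sat D v \<phi> \<longrightarrow> sat D v \<psi>)"
  "sat D v (Iff_form \<phi> \<psi>) \<longleftrightarrow> (sat D v \<phi> \<longleftrightarrow> sat D v \<psi>)"
  "sat D v (All_form i \<phi>) \<longleftrightarrow> (\<forall>a\<in>D. sat D (v(i := a)) \<phi>)"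
  by (auto simp: Imp_form_def Iff_form_def All_form_def)

text \<open>Sums of variable indices provide fresh bound variables.\<close>

definition Upair_form :: "nat \<Rightarrow> nat \<Rightarrow> nat \<Rightarrow> form" where
  "Upair_form u x y = (let w = u + x + y + 1 in
     All_form w (Iff_form (Mem w u) (Neg (Conj (Neg (Eq w x)) (Neg (Eq w y))))))"

definition Pair_form :: "nat \<Rightarrow> nat \<Rightarrow> nat \<Rightarrow> form" where
  "Pair_form p x y = (let u = p + x + y + 1; w = p + x + y + 2 in
     Ex u (Ex w (Conj (Upair_form u x x) (Conj (Upair_form w x y) (Upair_form p u w)))))"

definition Pair_Mem_form :: "nat \<Rightarrow> nat \<Rightarrow> nat \<Rightarrow> form" where
  "Pair_Mem_form x y s = (let p = x + y + s + 1 in Ex p (Conj (Mem p s) (Pair_form p x y)))"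

definition env :: "'k V set \<Rightarrow> (nat \<Rightarrow> 'k V) \<Rightarrow> bool" where
  "env D v \<longleftrightarrow> (\<forall>i. v i \<in> D)"

lemma env_const [simp]: "env D (\<lambda>_. a) \<longleftrightarrow> a \<in> D"
  by (simp add: env_def)

lemma env_fun_upd [simp]: "env D v \<Longrightarrow> a \<in> D \<Longrightarrow> env D (v(i := a))"
  by (simp add: env_def)

context regular_uncountable
begin

text \<open>As H(\<theta>) is transitive, the quantifier over it sees all elements of
  \<open>v u\<close>; extensionality does the rest.\<close>

lemma sat_Upair_form:
  assumes "env (Hset \<theta>) v"
  shows "sat (Hset \<theta>) v (Upair_form u x y) \<longleftrightarrow> v u = vset {v x, v y}"
proof -
  have H: "v i \<in> Hset \<theta>" for i using assms by (simp add: env_def)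
  have "(\<forall>a\<in>Hset \<theta>. a \<in> elts (v u) \<longleftrightarrow> a = v x \<or> a = v y) \<longleftrightarrow> elts (v u) = {v x, v y}"
    using Hset_trans[OF _ H[of u]] H[of x] H[of y] by blast
  also have "\<dots> \<longleftrightarrow> v u = vset {v x, v y}"
    using elts_inject[of "v u" "vset {v x, v y}"] by auto
  finally show ?thesis
    by (simp add: Upair_form_def Let_def)
qed

lemma sat_Pair_form:
  assumes "env (Hset \<theta>) v"
  shows "sat (Hset \<theta>) v (Pair_form p x y) \<longleftrightarrow> v p = vpair (v x) (v y)"
proof -
  have H: "v i \<in> Hset \<theta>" for i using assms by (simp add: env_def)
  then show ?thesis
    using assms vset_insert_in_Hset[OF H H] vset_insert_in_Hset[OF H[of x] H[of x]]
    by (simp add: Pair_form_def Let_def sat_Upair_form vpair_def conj_commute cong: bex_cong_simp conj_cong)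
qed

lemma sat_Pair_Mem_form:
  assumes "env (Hset \<theta>) v"
  shows "sat (Hset \<theta>) v (Pair_Mem_form x y s) \<longleftrightarrow> vpair (v x) (v y) \<in> elts (v s)"
proof -
  have H: "v i \<in> Hset \<theta>" for i using assms by (simp add: env_def)
  then have "vpair (v x) (v y) \<in> Hset \<theta>" by (intro vpair_in_Hset)
  then show ?thesis
    using assms by (auto simp: Pair_Mem_form_def Let_def sat_Pair_form cong: bex_cong_simp)
qed

lemmas sat_forms = sat_Pair_form sat_Pair_Mem_form

end


section \<open>Elementary submodels\<close>

locale elementary = regular_uncountable \<theta> for \<theta> :: "'k rel" +
  fixes M :: "'k V set"
  assumes elementary: "elem_submodel \<theta> M"
begin

lemma subset_Hset: "x \<in> M \<Longrightarrow> x \<in> Hset \<theta>"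
  using elementary by (auto simp: elem_submodel_def)

text \<open>Elementarity takes \<open>Ex i \<phi>\<close> down to \<open>M\<close> and the instance
  found there back up. It is applied below only in this form, so formulas need evaluation in
  H(\<theta>) only.\<close>

lemma witness:
  assumes "env M v" and "a \<in> Hset \<theta>" and "sat (Hset \<theta>) (v(i := a)) \<phi>"
  obtains b where "b \<in> M" and "sat (Hset \<theta>) (v(i := b)) \<phi>"
proof -
  have *: "sat M w \<psi> \<longleftrightarrow> sat (Hset \<theta>) w \<psi>" if "env M w" for w \<psi>
    using elementary that unfolding elem_submodel_def env_def by blast
  have "sat (Hset \<theta>) v (Ex i \<phi>)" using assms by auto
  then have "sat M v (Ex i \<phi>)" using * assms by blast
  then obtain b where "b \<in> M" "sat M (v(i := b)) \<phi>" by auto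
  then show ?thesis using that *[of "v(i := b)"] assms(1) by simp
qed

lemma vpair_in_M_D:
  assumes "vpair x y \<in> M"
  shows "x \<in> M" and "y \<in> M"
proof -
  let ?v = "\<lambda>_ :: nat. vpair x y"
  have H: "x \<in> Hset \<theta>" "y \<in> Hset \<theta>" "env (Hset \<theta>) ?v" and v: "env M ?v"
    using vpair_in_HsetD[OF subset_Hset[OF assms]] subset_Hset[OF assms] assms by auto
  have "sat (Hset \<theta>) (?v(1 := x)) (Ex 2 (Pair_form 0 1 2))"
    using H by (auto simp: sat_forms)
  from witness[OF v H(1) this] obtain b where
    "b \<in> M" "sat (Hset \<theta>) (?v(1 := b)) (Ex 2 (Pair_form 0 1 2))" .
  with H show "x \<in> M"
    by (auto simp: sat_forms subset_Hset)
  have "sat (Hset \<theta>) (?v(2 := y)) (Ex 1 (Pair_form 0 1 2))"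
    using H by (auto simp: sat_forms)
  from witness[OF v H(2) this] obtain b where
    "b \<in> M" "sat (Hset \<theta>) (?v(2 := b)) (Ex 1 (Pair_form 0 1 2))" .
  with H show "y \<in> M"
    by (auto simp: sat_forms subset_Hset)
qed

text \<open>Uniqueness makes \<open>y\<close> definable from \<open>S\<close> and
  \<open>x\<close>.\<close>

lemma pair_successor_in_M:
  assumes "S \<in> M" and "x \<in> M" and "vpair x y \<in> elts S"
    and unique: "\<And>z. vpair x z \<in> elts S \<Longrightarrow> z = y"
  shows "y \<in> M"
proof -
  let ?v = "(\<lambda>_ :: nat. S)(1 := x)"
  have y: "y \<in> Hset \<theta>"
    using assms subset_Hset Hset_trans vpair_in_HsetD by metis
  have v: "env M ?v" and H: "env (Hset \<theta>) ?v"
    using assms subset_Hset by auto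
  have "sat (Hset \<theta>) (?v(2 := y)) (Pair_Mem_form 1 2 0)"
    using assms(3) y H by (simp add: sat_forms)
  from witness[OF v y this] obtain b where
    b: "b \<in> M" "sat (Hset \<theta>) (?v(2 := b)) (Pair_Mem_form 1 2 0)" .
  then have "vpair x b \<in> elts S"
    using H by (simp add: sat_forms subset_Hset)
  then show ?thesis
    using unique b(1) by blast
qed

lemma separation_in_M:
  assumes "D \<in> M" and "B \<in> M" and "e \<in> M"
  shows "vset {z \<in> elts D. \<exists>y\<in>elts B. vpair z y \<in> elts e} \<in> M"
proof -
  let ?X = "{z \<in> elts D. \<exists>y\<in>elts B. vpair z y \<in> elts e}"
  \<comment> \<open>Variable 0 is reserved for the set being defined; variable 1 keeps the default
    value \<open>D\<close>.\<close>
  let ?v = "(\<lambda>_ :: nat. D)(2 := B, 3 := e)"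
  let ?\<phi> = "All_form 4 (Iff_form (Mem 4 0) (Conj (Mem 4 1) (Ex 5 (Conj (Mem 5 2) (Pair_Mem_form 4 5 3)))))"
  have DH: "D \<in> Hset \<theta>" "B \<in> Hset \<theta>" "e \<in> Hset \<theta>"
    using assms subset_Hset by auto
  have X: "vset ?X \<in> Hset \<theta>" "elts (vset ?X) = ?X"
    by (rule vset_subset_in_Hset[OF DH(1)]; blast)+
  have v: "env M ?v" and H: "env (Hset \<theta>) ?v"
    using assms DH by auto
  have sat: "sat (Hset \<theta>) (?v(0 := a)) ?\<phi> \<longleftrightarrow> elts a = ?X" if "a \<in> Hset \<theta>" for a
  proof -
    have "sat (Hset \<theta>) (?v(0 := a)) ?\<phi> \<longleftrightarrow>
      (\<forall>z\<in>Hset \<theta>. z \<in> elts a \<longleftrightarrow> z \<in> elts D \<and> (\<exists>y\<in>Hset \<theta>. y \<in> elts B \<and> vpair z y \<in> elts e))"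
      using H that by (simp add: sat_forms cong: ball_cong_simp bex_cong_simp)
    also have "\<dots> \<longleftrightarrow> elts a = ?X"
      using Hset_trans that DH by blast
    finally show ?thesis .
  qed
  have "sat (Hset \<theta>) (?v(0 := vset ?X)) ?\<phi>"
    using sat X by blast
  from witness[OF v X(1) this] obtain b where
    b: "b \<in> M" "sat (Hset \<theta>) (?v(0 := b)) ?\<phi>" .
  then have "elts b = ?X"
    using sat subset_Hset by blast
  then show ?thesis
    using b(1) vset_elts by metis
qed

text \<open>
  That a point \<open>d\<close> and a partial function \<open>S\<close> generate \<open>D\<close> is expressible over \<open>H(\<theta>)\<close>, since all
  subsets of \<open>D\<close> lie in \<open>H(\<theta>)\<close>. So if \<open>D\<close> is countable, such \<open>S\<close> and \<open>d\<close> exist in \<open>M\<close>, and then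
  \<open>D \<inter> M\<close> contains \<open>d\<close> and is closed under \<open>S\<close>. This avoids natural numbers inside the universe.
\<close>

lemma countable_subset_M:
  assumes "D \<in> M" and "countable (elts D)"
  shows "elts D \<subseteq> M"
proof (cases "elts D = {}")
  case False
  from countable_obtain_successor[OF assms(2) False]
  obtain R d where R: "R \<subseteq> elts D \<times> elts D" "single_valued R" "d \<in> elts D"
    and gen: "\<forall>X. d \<in> X \<and> R `` X \<subseteq> X \<longrightarrow> elts D \<subseteq> X" .
  have DH: "D \<in> Hset \<theta>" using assms subset_Hset by auto
  have elts_DH: "x \<in> Hset \<theta>" if "x \<in> elts D" for x
    using that DH by (rule Hset_trans)
  define P where "P = (\<lambda>(x, y). vpair x y) ` R"
  have "countable R"
    using R(1) by (rule countable_subset) (intro countable_SIGMA assms(2))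
  then have "countable P"
    unfolding P_def by (rule countable_image)
  moreover have "P \<subseteq> Hset \<theta>"
    unfolding P_def using R(1) elts_DH by (auto intro!: vpair_in_Hset)
  ultimately have PH: "vset P \<in> Hset \<theta>" and eP: "elts (vset P) = P"
    by (simp_all add: vset_in_Hset countable_less_theta elts_vset small_countable)
  have inP: "vpair x y \<in> P \<longleftrightarrow> (x, y) \<in> R" for x y
    unfolding P_def by (auto intro: rev_image_eqI)
  define fn where "fn S \<longleftrightarrow> (\<forall>x\<in>Hset \<theta>. \<forall>y\<in>Hset \<theta>. \<forall>z\<in>Hset \<theta>.
      vpair x y \<in> elts S \<and> vpair x z \<in> elts S \<longrightarrow> y = z)" for S
  define gn where "gn S c \<longleftrightarrow> (\<forall>X\<in>Hset \<theta>. c \<in> elts X \<and>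
      (\<forall>x\<in>Hset \<theta>. \<forall>y\<in>Hset \<theta>. x \<in> elts X \<and> vpair x y \<in> elts S \<and> y \<in> elts D
        \<longrightarrow> y \<in> elts X) \<longrightarrow>
      (\<forall>x\<in>Hset \<theta>. x \<in> elts D \<longrightarrow> x \<in> elts X))" for S c
  let ?fn = "All_form 3 (All_form 4 (All_form 5 (Imp_form (Conj (Pair_Mem_form 3 4 0) (Pair_Mem_form 3 5 0)) (Eq 4 5))))"
  let ?gn = "All_form 6 (Imp_form (Conj (Mem 1 6) (All_form 3 (All_form 4 (Imp_form (Conj (Mem 3 6) (Conj (Pair_Mem_form 3 4 0) (Mem 4 2))) (Mem 4 6)))))
      (All_form 3 (Imp_form (Mem 3 2) (Mem 3 6))))"
  define \<phi> where "\<phi> = Conj ?fn (Conj (Mem 1 2) ?gn)"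
  let ?v = "\<lambda>_ :: nat. D"
  have sat: "sat (Hset \<theta>) (?v(0 := S, 1 := c)) \<phi> \<longleftrightarrow> fn S \<and> c \<in> elts D \<and> gn S c"
    if "S \<in> Hset \<theta>" "c \<in> Hset \<theta>" for S c
  proof -
    show ?thesis
      unfolding \<phi>_def sat_simps sat.simps fn_def gn_def
      by (intro arg_cong2[where f = "(\<and>)"] arg_cong2[where f = "(\<longrightarrow>)"] ball_cong refl)
        (simp_all add: sat_forms that DH)
  qed
  have "d \<in> Hset \<theta>" using R(3) by (rule elts_DH)
  moreover have "fn (vset P)"
    unfolding fn_def eP inP using R(2) by (auto dest: single_valuedD)
  moreover have "gn (vset P) d"
    unfolding gn_def eP inP
  proof safe
    fix X x
    assume "X \<in> Hset \<theta>" "d \<in> elts X" "x \<in> elts D"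
      and "\<forall>x\<in>Hset \<theta>. \<forall>y\<in>Hset \<theta>. x \<in> elts X \<and> (x, y) \<in> R \<and> y \<in> elts D \<longrightarrow> y \<in> elts X"
    then have "R `` elts X \<subseteq> elts X"
      using R(1) elts_DH by blast
    then show "x \<in> elts X"
      using gen \<open>d \<in> elts X\<close> \<open>x \<in> elts D\<close> by blast
  qed
  ultimately have "sat (Hset \<theta>) (?v(0 := vset P)) (Ex 1 \<phi>)"
    using sat[OF PH] R(3) by auto
  moreover have "env M ?v" using assms by auto
  \<comment> \<open>Elementarity is used twice: first for an \<open>S\<close> in \<open>M\<close>
    that has some generator in H(\<theta>), then for a generator \<open>c\<close> in
    \<open>M\<close> of this \<open>S\<close>.\<close>
  ultimately obtain S where S: "S \<in> M" "sat (Hset \<theta>) (?v(0 := S)) (Ex 1 \<phi>)"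
    using witness PH by blast
  then obtain c' where "c' \<in> Hset \<theta>" "sat (Hset \<theta>) (?v(0 := S, 1 := c')) \<phi>"
    by auto
  moreover have "env M (?v(0 := S))" using S assms by auto
  ultimately obtain c where c: "c \<in> M" "sat (Hset \<theta>) (?v(0 := S, 1 := c)) \<phi>"
    using witness by blast
  then have fn: "fn S" and cD: "c \<in> elts D" and gn: "gn S c"
    using sat subset_Hset S(1) by blast+
  have SH: "S \<in> Hset \<theta>" using S subset_Hset by blast
  \<comment> \<open>As a subset of \<open>D\<close>, this set lies in H(\<theta>), which is all that
    \<open>gn\<close> asks for; its membership in \<open>M\<close> is not claimed.\<close>
  obtain Y where Y: "Y \<in> Hset \<theta>" "elts Y = elts D \<inter> M"
    using vset_subset_in_Hset[OF DH Int_lower1] by blast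
  have step: "y \<in> M" if "x \<in> M" "vpair x y \<in> elts S" for x y
  proof (rule pair_successor_in_M[OF S(1) that])
    fix z assume "vpair x z \<in> elts S"
    then have "x \<in> Hset \<theta>" "y \<in> Hset \<theta>" "z \<in> Hset \<theta>"
      using vpair_in_HsetD[OF Hset_trans[OF _ SH]] that(2) by blast+
    then show "z = y"
      using fn that(2) \<open>vpair x z \<in> elts S\<close> unfolding fn_def by blast
  qed
  have "\<forall>x\<in>Hset \<theta>. \<forall>y\<in>Hset \<theta>. x \<in> elts Y \<and> vpair x y \<in> elts S \<and> y \<in> elts D
      \<longrightarrow> y \<in> elts Y"
    unfolding Y(2) using step by blast
  moreover have "c \<in> elts Y"
    unfolding Y(2) using cD c(1) by blast
  ultimately have "\<forall>x\<in>Hset \<theta>. x \<in> elts D \<longrightarrow> x \<in> elts Y"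
    using gn Y(1) unfolding gn_def by blast
  then show ?thesis
    unfolding Y(2) using elts_DH by blast
qed simp

end


section \<open>Uncountably many common classes\<close>

lemma omega1_ordLeq:
  assumes "uncountable Q"
  shows "|omega1| \<le>o |Q|"
proof -
  have "\<not> |Q| \<le>o natLeq"
    using assms by (simp add: countable_card_le_natLeq)
  then have "natLeq <o |Q|"
    using natLeq_Well_order card_of_Well_order not_ordLeq_iff_ordLess by blast
  then have "cardSuc natLeq \<le>o |Q|"
    using natLeq_Card_order card_of_Card_order cardSuc_ordLess_ordLeq by blast
  moreover have "|omega1| =o cardSuc natLeq"
    unfolding omega1_def by (intro card_of_Field_ordIso cardSuc_Card_order natLeq_Card_order)
  ultimately show ?thesis
    using ordIso_ordLeq_trans by blast
qed

lemma obtain_omega1_classes: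
  assumes R: "equiv A R" and D: "uncountable D" "D \<subseteq> A"
    and fin: "\<And>z. z \<in> D \<Longrightarrow> finite (D \<inter> R `` {z})"
  obtains h :: "nat set \<Rightarrow> 'a" where "h ` omega1 \<subseteq> D"
    and "\<And>a b. a \<in> omega1 \<Longrightarrow> b \<in> omega1 \<Longrightarrow> (h a, h b) \<in> R \<longleftrightarrow> a = b"
proof -
  let ?Q = "(\<lambda>z. R `` {z}) ` D"
  have "uncountable ?Q"
  proof
    assume "countable ?Q"
    then have "countable (\<Union>C\<in>?Q. D \<inter> C)"
      using fin by (intro countable_UN) (auto intro: countable_finite)
    moreover have "D \<subseteq> (\<Union>C\<in>?Q. D \<inter> C)"
      using D(2) equiv_class_self[OF R] by blast
    ultimately show False
      using D(1) countable_subset by blast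
  qed
  then obtain g where g: "inj_on g omega1" "g ` omega1 \<subseteq> ?Q"
    using omega1_ordLeq card_of_ordLeq by metis
  define h where "h a = (SOME z. z \<in> D \<and> g a = R `` {z})" for a
  have h: "h a \<in> D \<and> g a = R `` {h a}" if "a \<in> omega1" for a
    unfolding h_def by (rule someI_ex) (use g(2) that in blast)
  show ?thesis
  proof
    show "h ` omega1 \<subseteq> D" using h by blast
    fix a b assume ab: "a \<in> omega1" "b \<in> omega1"
    then have "h a \<in> A" "h b \<in> A"
      using h D(2) by blast+
    then have "(h a, h b) \<in> R \<longleftrightarrow> R `` {h a} = R `` {h b}"
      by (simp add: eq_equiv_class_iff[OF R])
    also have "\<dots> \<longleftrightarrow> g a = g b"
      using h[OF ab(1)] h[OF ab(2)] by simp
    also have "\<dots> \<longleftrightarrow> a = b"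
      using g(1) ab by (rule inj_on_eq_iff)
    finally show "(h a, h b) \<in> R \<longleftrightarrow> a = b" .
  qed
qed

section \<open>Cubes from classes that meet several given classes\<close>

lemma two_gridD:
  assumes "two_grid A E" and "k < 2"
  shows "equiv A (E k)" and "a \<in> A \<Longrightarrow> finite (E k `` {a} \<inter> E (1 - k) `` {a})"
  using assms less_2_cases[of k] by (auto simp: two_grid_def Int_commute)

text \<open>The \<open>E k\<close>-classes are to be indexed by \<open>omega1\<close> and the
  \<open>E (1 - k)\<close>-classes by \<open>{..<l}\<close>; since \<open>E 0\<close> compares
  second coordinates, \<open>k = 0\<close> puts \<open>omega1\<close> second. Both cases are then
  treated at once, \<open>1 - k\<close> being the other index.\<close>

definition cube_along :: "nat \<Rightarrow> nat \<Rightarrow> 'a set \<Rightarrow> (nat \<Rightarrow> 'a rel) \<Rightarrow> bool" where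
  "cube_along k l A E \<longleftrightarrow>
    (if k = 0 then cube_embeds {..<l} omega1 A E else cube_embeds omega1 {..<l} A E)"

lemma cube_alongI:
  fixes l :: nat and p :: "nat \<Rightarrow> nat set \<Rightarrow> 'a"
  assumes "two_grid A E" and "k < 2"
    and p: "\<And>i a. i < l \<Longrightarrow> a \<in> omega1 \<Longrightarrow> p i a \<in> A"
    and same: "\<And>i j a b. i < l \<Longrightarrow> j < l \<Longrightarrow> a \<in> omega1 \<Longrightarrow> b \<in> omega1 \<Longrightarrow>
        (p i a, p j b) \<in> E k \<longleftrightarrow> a = b"
    and other: "\<And>i j a b. i < l \<Longrightarrow> j < l \<Longrightarrow> a \<in> omega1 \<Longrightarrow> b \<in> omega1 \<Longrightarrow>
        (p i a, p j b) \<in> E (1 - k) \<longleftrightarrow> i = j"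
  shows "cube_along k l A E"
proof -
  \<comment> \<open>By the diagonal instances of \<open>same\<close> and \<open>other\<close>, a
    common value is related to itself both ways, which forces equal indices.\<close>
  have inj: "i = j \<and> a = b"
    if "p i a = p j b" "i < l" "j < l" "a \<in> omega1" "b \<in> omega1" for i j a b
    using same[OF that(2-5)] other[OF that(2-5)] same[of i i a a] other[of i i a a] that by metis
  consider "k = 0" | "k = 1" using assms(2) by linarith
  then show ?thesis
  proof cases
    case 1
    have "grid_embedding (\<lambda>(i, a). p i a) ({..<l} \<times> omega1) (cube {..<l} omega1) A E"
      unfolding grid_embedding_def cube_def
      using 1 p same other inj by (auto simp: inj_on_def less_2_cases_iff)
    then show ?thesis using 1 by (auto simp: cube_along_def cube_embeds_def)
  next
    case 2
    have "grid_embedding (\<lambda>(a, i). p i a) (omega1 \<times> {..<l}) (cube omega1 {..<l}) A E"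
      unfolding grid_embedding_def cube_def
      using 2 p same other inj by (auto simp: inj_on_def less_2_cases_iff)
    then show ?thesis using 2 by (auto simp: cube_along_def cube_embeds_def)
  qed
qed

lemma cube_along_if_uncountable:
  fixes x :: "nat \<Rightarrow> 'a" and l :: nat
  assumes grid: "two_grid A E" and k: "k < 2" and x: "\<And>i. x i \<in> A"
    and distinct: "\<And>i j. (x i, x j) \<in> E (1 - k) \<Longrightarrow> i = j"
    and unc: "uncountable {z \<in> E (1 - k) `` {x 0}. \<forall>i<l. \<exists>y\<in>E (1 - k) `` {x i}. (z, y) \<in> E k}"
      (is "uncountable ?D")
  shows "cube_along k l A E"
proof -
  have R: "equiv A (E k)" and R': "equiv A (E (1 - k))"
    using two_gridD(1)[OF grid] k by auto
  have DA: "?D \<subseteq> A"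
    using R' by (auto simp: equiv_def)
  have "finite (?D \<inter> E k `` {z})" if "z \<in> ?D" for z
  proof (rule finite_subset)
    have "E (1 - k) `` {x 0} = E (1 - k) `` {z}"
      using that equiv_class_eq[OF R'] by blast
    then show "?D \<inter> E k `` {z} \<subseteq> E k `` {z} \<inter> E (1 - k) `` {z}" by blast
    show "finite (E k `` {z} \<inter> E (1 - k) `` {z})"
      using two_gridD(2)[OF grid k] that DA by blast
  qed
  then obtain h :: "nat set \<Rightarrow> 'a" where h: "h ` omega1 \<subseteq> ?D"
    and hR: "\<And>a b. a \<in> omega1 \<Longrightarrow> b \<in> omega1 \<Longrightarrow> (h a, h b) \<in> E k \<longleftrightarrow> a = b"
    using obtain_omega1_classes[OF R unc DA] by blast
  have "\<exists>y. (x i, y) \<in> E (1 - k) \<and> (h a, y) \<in> E k" if "i < l" "a \<in> omega1" for i a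
    using h that by blast
  then obtain p where p: "\<And>i a. i < l \<Longrightarrow> a \<in> omega1 \<Longrightarrow> (x i, p i a) \<in> E (1 - k)"
      "\<And>i a. i < l \<Longrightarrow> a \<in> omega1 \<Longrightarrow> (h a, p i a) \<in> E k"
    by metis
  have sym: "sym (E k)" "sym (E (1 - k))" and trans: "trans (E k)" "trans (E (1 - k))"
    using R R' by (auto simp: equiv_def)
  show ?thesis
  proof (rule cube_alongI[OF grid k])
    fix i a assume i: "i < l" and a: "a \<in> omega1"
    show "p i a \<in> A" using p(2)[OF i a] R by (auto simp: equiv_def)
    fix j b assume j: "j < l" and b: "b \<in> omega1"
    have "(p i a, p j b) \<in> E k \<longleftrightarrow> (h a, h b) \<in> E k"
      using p(2)[OF i a] p(2)[OF j b] sym trans by (meson symD transD)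
    then show "(p i a, p j b) \<in> E k \<longleftrightarrow> a = b"
      using hR a b by blast
    have "(p i a, p j b) \<in> E (1 - k) \<longleftrightarrow> (x i, x j) \<in> E (1 - k)"
      using p(1)[OF i a] p(1)[OF j b] sym trans by (meson symD transD)
    also have "\<dots> \<longleftrightarrow> i = j"
      using distinct equiv_class_self[OF R' x] by blast
    finally show "(p i a, p j b) \<in> E (1 - k) \<longleftrightarrow> i = j" .
  qed
qed

text \<open>Inside the single \<open>E k\<close>-class \<open>C\<close> every
  \<open>E (1 - k)\<close>-class is finite, so by the pigeonhole principle infinitely many of them
  meet \<open>C \<inter> B\<close>.\<close>

lemma obtain_distinct_classes:
  assumes grid: "two_grid A E" and k: "k < 2" and C: "C \<in> A // E k"
    and inf: "infinite (C \<inter> B)"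
  obtains x :: "nat \<Rightarrow> 'a" where "range x \<subseteq> C \<inter> B"
    and "\<forall>i j. (x i, x j) \<in> E (1 - k) \<longrightarrow> i = j"
proof -
  have R: "equiv A (E k)" and R': "equiv A (E (1 - k))"
    using two_gridD(1)[OF grid] k by auto
  have CA: "C \<subseteq> A" using C R in_quotient_imp_subset by blast
  let ?cl = "\<lambda>z. E (1 - k) `` {z}"
  have "infinite (?cl ` (C \<inter> B))"
  proof
    assume "finite (?cl ` (C \<inter> B))"
    then obtain z where z: "z \<in> C \<inter> B" "infinite {w \<in> C \<inter> B. ?cl w = ?cl z}"
      using pigeonhole_infinite[OF inf] by blast
    have "{w \<in> C \<inter> B. ?cl w = ?cl z} \<subseteq> E k `` {z} \<inter> ?cl z"
      using z(1) CA equiv_class_self[OF R'] quotient_eq_iff[OF R C C] by blast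
    then show False
      using z two_gridD(2)[OF grid k, of z] CA finite_subset by blast
  qed
  then obtain g :: "nat \<Rightarrow> 'a set" where g: "inj g" "range g \<subseteq> ?cl ` (C \<inter> B)"
    using infinite_countable_subset by blast
  then have "\<forall>i. \<exists>z\<in>C \<inter> B. g i = ?cl z" by blast
  then obtain x where x: "\<And>i. x i \<in> C \<inter> B" "\<And>i. g i = ?cl (x i)" by metis
  show ?thesis
  proof (rule that)
    show "range x \<subseteq> C \<inter> B" using x(1) by blast
    have "i = j" if "(x i, x j) \<in> E (1 - k)" for i j
    proof -
      have "g i = g j" using that x(2) equiv_class_eq[OF R'] by blast
      then show "i = j" using g(1) by (simp add: inj_eq)
    qed
    then show "\<forall>i j. (x i, x j) \<in> E (1 - k) \<longrightarrow> i = j" by blast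
  qed
qed

text \<open>All \<open>x i\<close> lie in \<open>C\<close>, so \<open>x i\<close> itself witnesses
  that the \<open>R\<close>-class of \<open>x 0\<close> meets the \<open>R'\<close>-class of
  \<open>x i\<close>. Thus \<open>x 0\<close> belongs to a set in \<open>M\<close> without belonging
  to \<open>M\<close>.\<close>

lemma (in elementary) uncountable_common_classes:
  fixes x :: "nat \<Rightarrow> 'k V"
  assumes A: "small A" and R: "equiv A R" and R': "equiv A R'" and RM: "vrel R \<in> M"
    and x: "\<And>i. x i \<in> C" "C \<in> A // R" "x 0 \<notin> M" "\<And>i. vset (R' `` {x i}) \<in> M"
  shows "uncountable {z \<in> R' `` {x 0}. \<forall>i<l. \<exists>y\<in>R' `` {x i}. (z, y) \<in> R}"
proof -
  define B where "B i = R' `` {x i}" for i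
  \<comment> \<open>The sequence \<open>x\<close> is not assumed to lie in \<open>M\<close>, so the
    set is reached by finitely many separations, each with a single \<open>B n\<close> as
    parameter.\<close>
  define D where "D n = {z \<in> B 0. \<forall>i<n. \<exists>y\<in>B i. (z, y) \<in> R}" for n :: nat
  have small: "small X" if "X \<subseteq> A" for X
    using A card_of_mono1[OF that] ordLeq_transitive unfolding small_def by blast
  have BA: "B i \<subseteq> A" for i
    using R' by (auto simp: B_def equiv_def)
  then have DA: "D n \<subseteq> A" for n by (auto simp: D_def)
  have eB: "elts (vset (B i)) = B i" and eD: "elts (vset (D n)) = D n" for i n
    by (intro elts_vset small BA DA)+
  have "elts (vrel R) = {vpair y z | y z. (y, z) \<in> R}"
    using R A by (intro elts_vrel) (auto simp: equiv_def)
  then have eR: "vpair y z \<in> elts (vrel R) \<longleftrightarrow> (y, z) \<in> R" for y z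
    by auto
  have BM: "vset (B i) \<in> M" for i
    using x(4) unfolding B_def .
  have DM: "vset (D n) \<in> M" for n
  proof (induction n)
    case 0
    have "D 0 = B 0" by (simp add: D_def)
    then show ?case using BM by simp
  next
    case (Suc n)
    have "D (Suc n) = {z \<in> elts (vset (D n)). \<exists>y\<in>elts (vset (B n)). vpair z y \<in> elts (vrel R)}"
      unfolding eB eD eR by (auto simp: D_def less_Suc_eq)
    then show ?case
      using separation_in_M[OF Suc BM[of n] RM] by simp
  qed
  have xA: "x i \<in> A" for i using x(1,2) R in_quotient_imp_subset by blast
  have "x i \<in> B i" for i
    using equiv_class_self[OF R' xA] by (simp add: B_def)
  moreover have "(x 0, x i) \<in> R" for i
    using quotient_eq_iff[OF R x(2) x(2) x(1) x(1)] by simp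
  ultimately have "x 0 \<in> D l" by (auto simp: D_def)
  then have "\<not> countable (D l)"
    using countable_subset_M[OF DM[of l]] x(3) eD[of l] by auto
  then show ?thesis by (simp add: D_def B_def)
qed

theorem theorem3p2:
  fixes \<theta> :: "'k rel" and A :: "'k V set" and E :: "nat \<Rightarrow> 'k V rel"
  assumes "Card_order \<theta>" and "regularCard \<theta>" and "natLeq <o \<theta>"
    and "small A" and "vgrid A E \<in> Hset \<theta>"
    and "two_grid A E" and "\<not> twisted \<theta> A E"
  shows "(\<forall>l::nat. cube_embeds {..<l} omega1 A E) \<or>
         (\<forall>l::nat. cube_embeds omega1 {..<l} A E)"
proof -
  obtain M k where M: "elem_submodel \<theta> M" "vgrid A E \<in> M" and k: "k < 2"
    and not_small: "\<not> rel_small A (E k) {x \<in> A - M. vset (E (1 - k) `` {x}) \<in> M}"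
    using assms(7) unfolding twisted_def by blast
  interpret elementary \<theta> M
    using assms M by unfold_locales
  obtain C where C: "C \<in> A // E k"
      "infinite (C \<inter> {x \<in> A - M. vset (E (1 - k) `` {x}) \<in> M})"
    using not_small unfolding rel_small_def by blast
  from obtain_distinct_classes[OF assms(6) k C]
  obtain x :: "nat \<Rightarrow> 'k V" where x: "range x \<subseteq> C \<inter> {x \<in> A - M. vset (E (1 - k) `` {x}) \<in> M}"
    and distinct: "\<forall>i j. (x i, x j) \<in> E (1 - k) \<longrightarrow> i = j" .
  have x: "x i \<in> C" "x i \<in> A" "x i \<notin> M" "vset (E (1 - k) `` {x i}) \<in> M" for i
    using x by blast+
  have "vpair (vrel (E 0)) (vrel (E 1)) \<in> M"
    using M(2) unfolding vgrid_def by (rule vpair_in_M_D)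
  then have "vrel (E 0) \<in> M" "vrel (E 1) \<in> M"
    by (rule vpair_in_M_D)+
  then have EM: "vrel (E k) \<in> M"
    using k by (auto simp: less_2_cases_iff)
  \<comment> \<open>The index \<open>k\<close> was fixed before \<open>l\<close>, so the same
    alternative holds for all \<open>l\<close>.\<close>
  have "cube_along k l A E" for l
  proof (rule cube_along_if_uncountable[OF assms(6) k x(2)])
    show "i = j" if "(x i, x j) \<in> E (1 - k)" for i j
      using that distinct by blast
    show "uncountable {z \<in> E (1 - k) `` {x 0}. \<forall>i<l. \<exists>y\<in>E (1 - k) `` {x i}. (z, y) \<in> E k}"
      using two_gridD(1)[OF assms(6)] k EM C(1) x
      by (intro uncountable_common_classes[OF assms(4)]) auto
  qed
  then show ?thesis
    by (cases "k = 0") (simp_all add: cube_along_def)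
qed

end
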